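(* Let $P\in\{X,Z\}$. Fix an admissible seam-measurement set $\mathcal M_P=\{(\bm e_j,\bm o_j,\sigma_j)\}_{j=1}^m$ with effective-row matrix $E_P\in\mathrm{GF}(2)^{m\times n}$ (rows $\bm e_1,\dots,\bm e_m$) and inference matrix $\widetilde O_P\in\mathrm{GF}(2)^{m\times N}$ (rows $\bm o_1,\dots,\bm o_m$), a pre-merge same-type stabilizer-constraint matrix $H_P^{\mathrm{sep}}\in\mathrm{GF}(2)^{h\times n}$, and a valid target joint logical representative $\bm\ell\in\mathrm{GF}(2)^{n}$ (a row vector). Then, using products of rows in this fixed admissible seam-measurement set, the requested joint parity can be extracted if and only if there exist binary selector (column) vectors $\bm\alpha\in\mathrm{GF}(2)^m$ and $\bm\gamma\in\mathrm{GF}(2)^h$ satisfying $$\bm\alpha^{\top}E_P\oplus\bm\gamma^{\top}H_P^{\mathrm{sep}}=\bm\ell .$$ When such a solution exists, the product of the selected effective seam rows (those $j$ with $\alpha_j=1$) differs from $\bm\ell$ only by pre-merge same-type stabilizer or super-stabilizer constraints (rows of $H_P^{\mathrm{sep}}$). Moreover, the seam selector $\bm\alpha$ induces a raw-outcome selector $$\bm\beta=\widetilde O_P^{\top}\bm\alpha\in\mathrm{GF}(2)^N,$$ so that, for the raw outcome record $\bm s_P^{[1:T]}\in\mathrm{GF}(2)^N$, the extracted merge parity (the XOR of the inferred outcomes of the selected effective seam rows) is $$s_{\mathrm{parity}}=\bm\beta^{\top}\bm s_P^{[1:T]} .$$ The sign of this joint-parity measurement is then recorded as the corresponding Pauli-frame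 information.
   Context: All arithmetic is over $\mathrm{GF}(2)$; $\oplus$ is addition (XOR). Two surface-code patches are to be merged by lattice surgery in order to measure the joint logical parity $P_L\otimes P_L$ with $P\in\{X,Z\}$. There are $n$ active data qubits in a fixed order. A binary row vector $\bm v\in\mathrm{GF}(2)^n$ is identified with the $P$-type Pauli operator $P(\bm v)=\bigotimes_{i=1}^n P^{v_i}$; products of $P$-type operators correspond to sums of supports. The "opposite type" is $Z$ if $P=X$ and $X$ if $P=Z$. Raw record: $\bm s_P^{[1:T]}\in\mathrm{GF}(2)^N$ is the column vector of all schedule-tagged raw (gauge or stabilizer) measurement outcome bits collected over the measurement rounds $1,\dots,T$. Admissible seam-measurement set: a finite set $\mathcal M_P=\{(\bm e_j,\bm o_j,\sigma_j)\}_{j=1}^m$, where $\bm e_j\in\mathrm{GF}(2)^n$ is the support of an effective $P$-type seam operator (an "effective seam row"), $\bm o_j\in\mathrm{GF}(2)^N$ is the binary selector reconstructing its outcome from the raw record (the outcome bit of $P(\bm e_j)$ is $\bm o_j\,\bm s_P^{[1:T]}$), and $\sigma_j$ is source, orientation and schedule metadata. Admissibility means that each outcome is directly measured or inferred from a specified product of available raw outcomes, that each $P(\bm e_j)$ commutes with all retained opposite-type constraints, that the required hardware resources and measurement rounds are available, and that (when two locally valid ancilla-repurposing orientations exist) an avoidably lossy orientation is not used. Pre-merge constraints: the rows of $H_P^{\mathrm{sep}}$ are the supports of the $P$-type stabilizer and super-stabilizer operators of the separated (pre-merge) configuration; their values are already fixed in the separated code space, so multiplying by them changes only the representative of a logical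 parity class. Target: $\bm\ell$ is the support of a representative of the desired joint logical parity $P_L\otimes P_L$ on the merged active-qubit set, chosen independently of $\mathcal M_P$. Extraction: a parity-extraction rule using the fixed set $\mathcal M_P$ is a product of effective seam rows of $\mathcal M_P$, i.e. $\prod_{j\in S}P(\bm e_j)$ for some $S\subseteq\{1,\dots,m\}$, followed by the post-processing of raw outcomes specified by the selectors $\bm o_j$, $j\in S$. The requested joint parity "can be extracted using products of rows in the fixed set" if there is such a rule whose operator equals $P(\bm\ell)$ up to multiplication by a product of operators $P(\bm h)$ with $\bm h$ rows of $H_P^{\mathrm{sep}}$ (same-type constraints already fixed before the merge). *)

theory Defs
  imports
    Complex_Main
    "HOL-Library.Z2"
    "Jordan_Normal_Form.Matrix"
begin

text \<open>Elements of GF(2) are of type \<^typ>\<open>bit\<close> and vectors over GF(2) are of type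
  \<^typ>\<open>bit vec\<close>, so that \<open>+\<close> is XOR. Qubits, seam rows, constraint rows and raw outcome bits
  are numbered from 0.\<close>

datatype pauli_type = PX | PZ

fun opposite :: "pauli_type \<Rightarrow> pauli_type" where
  "opposite PX = PZ"
| "opposite PZ = PX"

fun pauli_matrix :: "pauli_type \<Rightarrow> complex mat" where
  "pauli_matrix PX = mat_of_rows_list 2 [[0, 1], [1, 0]]"
| "pauli_matrix PZ = mat_of_rows_list 2 [[1, 0], [0, - 1]]"

definition pauli_pow :: "pauli_type \<Rightarrow> bit \<Rightarrow> complex mat" where
  "pauli_pow P b = (if b = 1 then pauli_matrix P else 1\<^sub>m 2)"

definition kron :: "complex mat \<Rightarrow> complex mat \<Rightarrow> complex mat" where
  "kron A B = mat (dim_row A * dim_row B) (dim_col A * dim_col B)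
     (\<lambda>(i, j). A $$ (i div dim_row B, j div dim_col B) * B $$ (i mod dim_row B, j mod dim_col B))"

text \<open>The operator \<open>P(v)\<close>, a square matrix of size \<open>2 ^ dim_vec v\<close>.\<close>

definition pauli_op :: "pauli_type \<Rightarrow> bit vec \<Rightarrow> complex mat" where
  "pauli_op P v = foldr kron (map (pauli_pow P) (list_of_vec v)) (1\<^sub>m 1)"

definition pauli_product :: "pauli_type \<Rightarrow> nat \<Rightarrow> bit vec list \<Rightarrow> complex mat" where
  "pauli_product P n vs = foldr (*) (map (pauli_op P) vs) (1\<^sub>m (2 ^ n))"

definition commutes :: "complex mat \<Rightarrow> complex mat \<Rightarrow> bool" where
  "commutes A B \<longleftrightarrow> A * B = B * A"


subsection \<open>Separated configuration and target parity\<close>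

text \<open>\<open>Hs\<close> and \<open>Ho\<close> hold the supports of the \<open>P\<close>-type and of the opposite-type stabilizers and
  super-stabilizers of the separated configuration.\<close>

definition separated_code :: "pauli_type \<Rightarrow> nat \<Rightarrow> bit mat \<Rightarrow> bit mat \<Rightarrow> bool" where
  "separated_code P n Hs Ho \<longleftrightarrow>
     dim_col Hs = n \<and> dim_col Ho = n \<and>
     (\<forall>a \<in> set (rows Hs). \<forall>b \<in> set (rows Ho).
        commutes (pauli_op P a) (pauli_op (opposite P) b))"

definition fixed_product :: "pauli_type \<Rightarrow> bit mat \<Rightarrow> complex mat \<Rightarrow> bool" where
  "fixed_product P Hs A \<longleftrightarrow>
     (\<exists>hs. set hs \<subseteq> set (rows Hs) \<and> A = pauli_product P (dim_col Hs) hs)"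

text \<open>\<open>P(l)\<close> is a logical \<open>P\<close>-operator of the patch with qubit set \<open>Q\<close>.\<close>

definition patch_logical ::
    "pauli_type \<Rightarrow> nat \<Rightarrow> bit mat \<Rightarrow> bit mat \<Rightarrow> nat set \<Rightarrow> bit vec \<Rightarrow> bool" where
  "patch_logical P n Hs Ho Q l \<longleftrightarrow>
     l \<in> carrier_vec n \<and>
     Q \<subseteq> {..<n} \<and> (\<forall>i<n. l $ i = 1 \<longrightarrow> i \<in> Q) \<and>
     (\<forall>b \<in> set (rows Ho). commutes (pauli_op P l) (pauli_op (opposite P) b)) \<and>
     \<not> fixed_product P Hs (pauli_op P l)"

text \<open>\<open>P(l)\<close> represents the joint parity of the patch logicals \<open>P(lA)\<close> and \<open>P(lB)\<close>: two
  representatives of a logical class differ by same-type constraints fixed before the merge.\<close>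

definition joint_logical_representative ::
    "pauli_type \<Rightarrow> nat \<Rightarrow> bit mat \<Rightarrow> bit mat \<Rightarrow> nat set \<Rightarrow> nat set \<Rightarrow>
     bit vec \<Rightarrow> bit vec \<Rightarrow> bit vec \<Rightarrow> bool" where
  "joint_logical_representative P n Hs Ho QA QB lA lB l \<longleftrightarrow>
     QA \<inter> QB = {} \<and>
     patch_logical P n Hs Ho QA lA \<and> patch_logical P n Hs Ho QB lB \<and>
     l \<in> carrier_vec n \<and>
     (\<exists>D. fixed_product P Hs D \<and> pauli_op P l = (pauli_op P lA * pauli_op P lB) * D)"


subsection \<open>Admissible seam-measurement sets\<close>

text \<open>The orientation is \<open>None\<close> for a row that does not repurpose an ancilla.\<close>

record ('src, 'ori) seam_meta =
  meta_source :: 'src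
  meta_orientation :: "'ori option"
  meta_rounds :: "nat set"

record ('src, 'ori) seam_row =
  seam_support :: "bit vec"
  seam_selector :: "bit vec"
  seam_metadata :: "('src, 'ori) seam_meta"

text \<open>The data against which admissibility is judged. A run is a raw record together with the outcome
  bit, in that run, of each effective operator (given by its support and metadata).\<close>

record ('src, 'ori) merge_env =
  env_rounds :: nat
  env_raw_round :: "nat \<Rightarrow> nat"
  env_raw_available :: "nat set"
  env_runs :: "(bit vec \<times> (bit vec \<Rightarrow> ('src, 'ori) seam_meta \<Rightarrow> bit)) set"
  env_retained_opposite :: "bit vec set"
  env_resources_available :: "('src, 'ori) seam_meta \<Rightarrow> bool"
  env_locally_valid :: "'src \<Rightarrow> 'ori \<Rightarrow> bool"
  env_lossy :: "'src \<Rightarrow> 'ori \<Rightarrow> bool"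

definition avoidably_lossy ::
    "('src, 'ori) merge_env \<Rightarrow> 'src \<Rightarrow> 'ori \<Rightarrow> bool" where
  "avoidably_lossy env x a \<longleftrightarrow>
     env_locally_valid env x a \<and> env_lossy env x a \<and>
     (\<exists>b. b \<noteq> a \<and> env_locally_valid env x b \<and> \<not> env_lossy env x b)"

text \<open>A row is directly measured if its selector has weight one; otherwise its outcome is inferred
  from the product of the selected raw outcomes.\<close>

definition admissible_row ::
    "('src, 'ori) merge_env \<Rightarrow> pauli_type \<Rightarrow> nat \<Rightarrow> nat \<Rightarrow> ('src, 'ori) seam_row \<Rightarrow> bool" where
  "admissible_row env P n N r \<longleftrightarrow>
     seam_support r \<in> carrier_vec n \<and>
     seam_selector r \<in> carrier_vec N \<and>
     (\<forall>k<N. seam_selector r $ k = 1 \<longrightarrow>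
        k \<in> env_raw_available env \<and> env_raw_round env k \<in> {1..env_rounds env}) \<and>
     (\<forall>(s, outcome) \<in> env_runs env. s \<in> carrier_vec N \<longrightarrow>
        outcome (seam_support r) (seam_metadata r) = seam_selector r \<bullet> s) \<and>
     (\<forall>b \<in> env_retained_opposite env.
        commutes (pauli_op P (seam_support r)) (pauli_op (opposite P) b)) \<and>
     env_resources_available env (seam_metadata r) \<and>
     meta_rounds (seam_metadata r) \<subseteq> {1..env_rounds env} \<and>
     (\<forall>a. meta_orientation (seam_metadata r) = Some a \<longrightarrow>
        \<not> avoidably_lossy env (meta_source (seam_metadata r)) a)"

definition admissible_seam_set ::
    "('src, 'ori) merge_env \<Rightarrow> pauli_type \<Rightarrow> nat \<Rightarrow> nat \<Rightarrow> ('src, 'ori) seam_row list \<Rightarrow> bool" where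
  "admissible_seam_set env P n N M \<longleftrightarrow>
     env_retained_opposite env \<subseteq> carrier_vec n \<and> (\<forall>r \<in> set M. admissible_row env P n N r)"

definition effective_row_matrix :: "nat \<Rightarrow> ('src, 'ori) seam_row list \<Rightarrow> bit mat" where
  "effective_row_matrix n M = mat_of_rows n (map seam_support M)"

definition inference_matrix :: "nat \<Rightarrow> ('src, 'ori) seam_row list \<Rightarrow> bit mat" where
  "inference_matrix N M = mat_of_rows N (map seam_selector M)"


subsection \<open>Parity extraction\<close>

text \<open>A parity-extraction rule is the index set \<open>S\<close> of the selected seam rows. The operators \<open>P(e\<^sub>j)\<close>
  commute, so multiplying them in increasing order of \<open>j\<close> is no restriction.\<close>

definition seam_product ::
    "pauli_type \<Rightarrow> nat \<Rightarrow> ('src, 'ori) seam_row list \<Rightarrow> nat set \<Rightarrow> complex mat" where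
  "seam_product P n M S =
     pauli_product P n (map (\<lambda>j. seam_support (M ! j)) (sorted_list_of_set S))"

definition inferred_outcome :: "('src, 'ori) seam_row \<Rightarrow> bit vec \<Rightarrow> bit" where
  "inferred_outcome r s = seam_selector r \<bullet> s"

definition extracted_parity ::
    "('src, 'ori) seam_row list \<Rightarrow> nat set \<Rightarrow> bit vec \<Rightarrow> bit" where
  "extracted_parity M S s = (\<Sum>j\<in>S. inferred_outcome (M ! j) s)"

definition extracts ::
    "pauli_type \<Rightarrow> nat \<Rightarrow> ('src, 'ori) seam_row list \<Rightarrow> bit mat \<Rightarrow> bit vec \<Rightarrow> nat set \<Rightarrow> bool" where
  "extracts P n M Hs l S \<longleftrightarrow>
     S \<subseteq> {..<length M} \<and>
     (\<exists>D. fixed_product P Hs D \<and> seam_product P n M S = pauli_op P l * D)"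

definition can_extract ::
    "pauli_type \<Rightarrow> nat \<Rightarrow> ('src, 'ori) seam_row list \<Rightarrow> bit mat \<Rightarrow> bit vec \<Rightarrow> bool" where
  "can_extract P n M Hs l \<longleftrightarrow> (\<exists>S. extracts P n M Hs l S)"

text \<open>The eigenvalue \<open>(-1)\<^sup>b\<close> belonging to an outcome bit.\<close>

definition outcome_sign :: "bit \<Rightarrow> int" where
  "outcome_sign b = (if b = 1 then - 1 else 1)"

text \<open>The Pauli-frame sign recorded for a joint-parity measurement: the product of the \<open>\<plusminus>1\<close>
  outcomes of the selected seam rows.\<close>

definition recorded_sign ::
    "('src, 'ori) seam_row list \<Rightarrow> nat set \<Rightarrow> bit vec \<Rightarrow> int" where
  "recorded_sign M S s = (\<Prod>j\<in>S. outcome_sign (inferred_outcome (M ! j) s))"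

definition selected :: "bit vec \<Rightarrow> nat set" where
  "selected v = {j. j < dim_vec v \<and> v $ j = 1}"

end

theory Submission
  imports Defs
begin

text \<open>For a fixed Pauli type, \<open>v \<mapsto> P(v)\<close> is an injective homomorphism from GF(2)^n into the
  complex matrices, with no phases since factors of one type never anticommute. Equality of operators
  up to products of constraints is therefore equality of supports up to a sum of rows of \<open>H\<close>. The
  formula for the raw-outcome selector is the adjointness of a matrix and its transpose.\<close>

section \<open>Kronecker products\<close>

lemma kron_carrier [intro]:
  assumes "A \<in> carrier_mat a b" and "B \<in> carrier_mat c d"
  shows "kron A B \<in> carrier_mat (a * c) (b * d)"
  using assms by (auto simp: kron_def)

text \<open>Quotient and remainder by \<open>d\<close> identify the indices below
  \<open>b * d\<close> with pairs, the encoding that \<open>kron\<close> uses. This splits the inner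
  sum of a product of Kronecker products.\<close>

lemma sum_div_mod:
  fixes f :: "nat \<Rightarrow> nat \<Rightarrow> 'a :: comm_monoid_add"
  shows "(\<Sum>k = 0..<b * d. f (k div d) (k mod d)) = (\<Sum>i = 0..<b. \<Sum>j = 0..<d. f i j)"
proof (cases "d = 0")
  case False
  have "(\<Sum>i = 0..<b. \<Sum>j = 0..<d. f i j) = (\<Sum>(i, j) \<in> {0..<b} \<times> {0..<d}. f i j)"
    by (simp add: sum.cartesian_product)
  also have "\<dots> = (\<Sum>k = 0..<b * d. f (k div d) (k mod d))"
  proof (rule sum.reindex_bij_witness[where i = "\<lambda>k. (k div d, k mod d)" and j = "\<lambda>(i, j). i * d + j"];
      clarsimp)
    fix i j assume "i < b" "j < d"
    then have "i * d + j < Suc i * d" by simp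
    also have "\<dots> \<le> b * d" using \<open>i < b\<close> by (intro mult_le_mono1) simp
    finally show "i * d + j < b * d" .
  next
    fix k assume "k < b * d"
    then show "k div d < b \<and> k mod d < d"
      using False by (simp add: less_mult_imp_div_less)
  qed
  finally show ?thesis by (rule sym)
qed simp

text \<open>The mixed-product rule: the inner index splits into a pair, after which the double sum
  factors into two single sums. It lets operators on several qubits be multiplied qubit by
  qubit.\<close>

lemma kron_mult:
  assumes "A \<in> carrier_mat a b" and "B \<in> carrier_mat c d"
    and "C \<in> carrier_mat b e" and "D \<in> carrier_mat d f"
  shows "kron A B * kron C D = kron (A * C) (B * D)"
proof (rule eq_matI)
  fix i j assume "i < dim_row (kron (A * C) (B * D))" "j < dim_col (kron (A * C) (B * D))"
  then have i: "i < a * c" and j: "j < e * f"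
    using assms by (auto simp: kron_def)
  \<comment> \<open>The existence of a valid index forces \<open>c\<close> and \<open>f\<close> to
    be positive, so the remainders below are in range.\<close>
  from i have "c > 0" by (cases c) auto
  from j have "f > 0" by (cases f) auto
  have bounds: "i div c < a" "i mod c < c" "j div f < e" "j mod f < f"
    using i j \<open>c > 0\<close> \<open>f > 0\<close> by (auto simp: less_mult_imp_div_less)
  have "(kron A B * kron C D) $$ (i, j) =
      (\<Sum>k = 0..<b * d. (A $$ (i div c, k div d) * B $$ (i mod c, k mod d)) *
        (C $$ (k div d, j div f) * D $$ (k mod d, j mod f)))"
    using assms i j by (auto simp: kron_def scalar_prod_def intro!: sum.cong)
  also have "\<dots> = (\<Sum>k = 0..<b. \<Sum>l = 0..<d. (A $$ (i div c, k) * B $$ (i mod c, l)) *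
        (C $$ (k, j div f) * D $$ (l, j mod f)))"
    by (rule sum_div_mod)
  also have "\<dots> = (A * C) $$ (i div c, j div f) * (B * D) $$ (i mod c, j mod f)"
    using assms bounds by (simp add: scalar_prod_def sum_product mult_ac)
  also have "\<dots> = kron (A * C) (B * D) $$ (i, j)"
    using assms i j by (simp add: kron_def)
  finally show "(kron A B * kron C D) $$ (i, j) = kron (A * C) (B * D) $$ (i, j)" .
qed (use assms in \<open>auto simp: kron_def\<close>)

lemma kron_one: "kron (1\<^sub>m a) (1\<^sub>m b) = 1\<^sub>m (a * b)"
proof (rule eq_matI)
  fix i j assume "i < dim_row (1\<^sub>m (a * b) :: complex mat)" "j < dim_col (1\<^sub>m (a * b) :: complex mat)"
  then have ij: "i < a * b" "j < a * b" by auto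
  then have "b > 0" by (cases b) auto
  moreover have "i = j \<longleftrightarrow> i div b = j div b \<and> i mod b = j mod b"
    by (metis div_mult_mod_eq)
  ultimately show "kron (1\<^sub>m a) (1\<^sub>m b) $$ (i, j) = 1\<^sub>m (a * b) $$ (i, j)"
    using ij by (auto simp: kron_def less_mult_imp_div_less)
qed (auto simp: kron_def)

text \<open>The block view of \<open>kron\<close>: block \<open>(p, q)\<close> is the scalar
  \<open>A $$ (p, q)\<close> times \<open>B\<close>. Addressing entries by block and offset avoids
  div and mod in the injectivity argument.\<close>

lemma kron_block:
  assumes "A \<in> carrier_mat a a" and "B \<in> carrier_mat d d"
    and "p < a" "q < a" "i < d" "j < d"
  shows "kron A B $$ (p * d + i, q * d + j) = A $$ (p, q) * B $$ (i, j)"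
proof -
  have "p * d + i < Suc p * d" "q * d + j < Suc q * d" using assms by auto
  moreover have "Suc p * d \<le> a * d" "Suc q * d \<le> a * d"
    using assms by (intro mult_le_mono1; simp)+
  ultimately have "p * d + i < a * d" "q * d + j < a * d" by linarith+
  then show ?thesis using assms by (simp add: kron_def)
qed

section \<open>Pauli operators as a faithful representation of GF(2)^n\<close>

lemma pauli_pow_carrier [simp, intro]: "pauli_pow P b \<in> carrier_mat 2 2"
  by (cases P) (auto simp: pauli_pow_def mat_of_rows_list_def)

lemma pauli_pow_mult: "pauli_pow P a * pauli_pow P b = pauli_pow P (a + b)"
  by (cases P; cases a; cases b)
    (auto simp: pauli_pow_def mat_of_rows_list_def scalar_prod_def less_2_cases_iff intro!: eq_matI)

lemma pauli_pow_index:
  "pauli_pow P b $$ (0, 0) = (if P = PX \<and> b = 1 then 0 else 1)"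
  "pauli_pow P b $$ (0, 1) = (if P = PX \<and> b = 1 then 1 else 0)"
  "pauli_pow P b $$ (1, 1) = (if b = 1 then if P = PX then 0 else - 1 else 1)"
  by (cases P; simp add: pauli_pow_def mat_of_rows_list_def)+

lemma pauli_op_vNil [simp]: "pauli_op P vNil = 1\<^sub>m 1"
  by (simp add: pauli_op_def)

lemma pauli_op_vCons [simp]: "pauli_op P (vCons a v) = kron (pauli_pow P a) (pauli_op P v)"
  by (simp add: pauli_op_def)

lemma pauli_op_carrier [intro]:
  "v \<in> carrier_vec n \<Longrightarrow> pauli_op P v \<in> carrier_mat (2 ^ n) (2 ^ n)"
proof (induction v arbitrary: n)
  case (vCons a v)
  then have "kron (pauli_pow P a) (pauli_op P v) \<in> carrier_mat (2 * 2 ^ dim_vec v) (2 * 2 ^ dim_vec v)"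
    by (intro kron_carrier) auto
  moreover have "n = Suc (dim_vec v)" using vCons.prems by (metis carrier_vecD dim_vec_vCons)
  ultimately show ?case by simp
qed auto

text \<open>Induction on the number of qubits: the mixed-product rule separates the first qubit,
  where the relation \<open>P * P = 1\<close> matches 1 + 1 = 0 in GF(2).\<close>

lemma pauli_op_add:
  assumes "u \<in> carrier_vec n" and "v \<in> carrier_vec n"
  shows "pauli_op P (u + v) = pauli_op P u * pauli_op P v"
  using assms
proof (induction n arbitrary: u v)
  case 0
  then have "u = vNil" "v = vNil" "u + v = vNil" by (auto intro!: eq_vecI)
  then show ?case by simp
next
  case (Suc n)
  obtain a u' where u: "u = vCons a u'" using Suc.prems by (cases u) auto
  obtain b v' where v: "v = vCons b v'" using Suc.prems by (cases v) auto
  have carr: "u' \<in> carrier_vec n" "v' \<in> carrier_vec n" using Suc.prems u v by auto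
  have "u + v = vCons (a + b) (u' + v')"
    using carr u v by (auto simp: vec_index_vCons intro!: eq_vecI)
  moreover have "kron (pauli_pow P a) (pauli_op P u') * kron (pauli_pow P b) (pauli_op P v') =
      kron (pauli_pow P a * pauli_pow P b) (pauli_op P u' * pauli_op P v')"
    by (rule kron_mult) (use carr in auto)
  ultimately show ?case using Suc.IH[OF carr] by (simp add: u v pauli_pow_mult)
qed

lemma pauli_op_zero [simp]: "pauli_op P (0\<^sub>v n) = 1\<^sub>m (2 ^ n)"
proof (induction n)
  case (Suc n)
  then show ?case by (simp add: zero_vec_Suc pauli_pow_def kron_one)
qed (simp add: pauli_op_def)

lemma bit_vec_add_self:
  fixes v :: "bit vec"
  assumes "v \<in> carrier_vec n"
  shows "v + v = 0\<^sub>v n"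
  using assms by (auto intro!: eq_vecI)

lemma pauli_op_involution:
  assumes "v \<in> carrier_vec n"
  shows "pauli_op P v * pauli_op P v = 1\<^sub>m (2 ^ n)"
  using pauli_op_add[OF assms assms] by (simp add: bit_vec_add_self[OF assms])

text \<open>A matrix squaring to the identity cannot vanish, because the dimension 2^n is positive
  even for n = 0. Injectivity needs a nonzero entry to cancel.\<close>

lemma pauli_op_nonzero:
  assumes "v \<in> carrier_vec n"
  shows "pauli_op P v \<noteq> 0\<^sub>m (2 ^ n) (2 ^ n)"
proof
  assume "pauli_op P v = 0\<^sub>m (2 ^ n) (2 ^ n)"
  with pauli_op_involution[OF assms, of P] have "0\<^sub>m (2 ^ n) (2 ^ n) = (1\<^sub>m (2 ^ n) :: complex mat)"
    by simp
  then have "0\<^sub>m (2 ^ n) (2 ^ n) $$ (0, 0) = (1\<^sub>m (2 ^ n) :: complex mat) $$ (0, 0)" by simp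
  then show False by simp
qed

text \<open>The first factor is read off the blocks of the Kronecker product: an \<open>X\<close> moves the nonzero
  blocks off the diagonal, a \<open>Z\<close> makes the two diagonal blocks opposite.\<close>

lemma pauli_op_inj:
  assumes "u \<in> carrier_vec n" and "v \<in> carrier_vec n" and "pauli_op P u = pauli_op P v"
  shows "u = v"
  using assms
proof (induction n arbitrary: u v)
  case (Suc n)
  obtain a u' where u: "u = vCons a u'" using Suc.prems by (cases u) auto
  obtain b v' where v: "v = vCons b v'" using Suc.prems by (cases v) auto
  have carr: "u' \<in> carrier_vec n" "v' \<in> carrier_vec n" using Suc.prems u v by auto
  let ?A = "pauli_op P u'" and ?B = "pauli_op P v'" and ?d = "2 ^ n :: nat"
  have AB: "?A \<in> carrier_mat ?d ?d" "?B \<in> carrier_mat ?d ?d" using carr by auto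
  \<comment> \<open>The assumed equality of operators, read at offset \<open>(i, j)\<close> inside
    block \<open>(p, q)\<close>.\<close>
  have block: "pauli_pow P a $$ (p, q) * ?A $$ (i, j) = pauli_pow P b $$ (p, q) * ?B $$ (i, j)"
    if "p < 2" "q < 2" "i < ?d" "j < ?d" for p q i j
    using arg_cong[OF Suc.prems(3), of "\<lambda>A. A $$ (p * ?d + i, q * ?d + j)"]
    by (simp add: u v kron_block[OF pauli_pow_carrier AB(1) that] kron_block[OF pauli_pow_carrier AB(2) that])
  obtain i j where ij: "i < ?d" "j < ?d" "?A $$ (i, j) \<noteq> 0"
    using pauli_op_nonzero[OF carr(1), of P] AB(1) by (auto simp: mat_eq_iff)
  \<comment> \<open>If \<open>a\<close> and \<open>b\<close> differed, then for X a block that is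
    zero on one side would equal one containing the nonzero entry. For Z the first diagonal block
    gives equal entries and the second opposite ones, again forcing the entry to be 0.\<close>
  have ab: "a = b"
    using block[OF _ _ ij(1,2), of 0 0] block[OF _ _ ij(1,2), of 0 1] block[OF _ _ ij(1,2), of 1 1] ij(3)
    by (cases a; cases b; cases P) (auto simp: pauli_pow_index[simplified])
  \<comment> \<open>The common first factor has a 1 at \<open>(0, 0)\<close> or at
    \<open>(0, 1)\<close>, so one of these blocks is the remaining operator itself.\<close>
  have "?A $$ (i, j) = ?B $$ (i, j)" if "i < ?d" "j < ?d" for i j
    using block[OF _ _ that, of 0 0] block[OF _ _ that, of 0 1] ab
    by (auto simp: pauli_pow_index[simplified] split: if_splits)
  then have "?A = ?B" using AB by (intro eq_matI) auto
  with Suc.IH[OF carr] ab show ?case by (simp add: u v)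
qed auto

section \<open>Products of operators and selector vectors\<close>

lemma pauli_product_eq_pauli_op:
  assumes "set vs \<subseteq> carrier_vec n"
  shows "pauli_product P n vs = pauli_op P (foldr (+) vs (0\<^sub>v n))"
    and "foldr (+) vs (0\<^sub>v n) \<in> carrier_vec n"
  using assms
  by (induction vs) (auto simp: pauli_product_def pauli_op_add[where n = n])

lemma foldr_add_vec_index:
  fixes vs :: "'a :: comm_monoid_add vec list"
  assumes "set vs \<subseteq> carrier_vec n" and "i < n"
  shows "foldr (+) vs (0\<^sub>v n) $ i = (\<Sum>v\<leftarrow>vs. v $ i)"
  using assms
proof (induction vs)
  case (Cons v vs)
  have "foldr (+) vs (0\<^sub>v n) \<in> carrier_vec n"
    using Cons.prems(1) by (induction vs) auto
  with Cons show ?case by simp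
qed simp

text \<open>Multiplying by a bit either keeps or drops a summand. This is the bridge between index
  sets, in which extraction rules are phrased, and matrix algebra over GF(2).\<close>

lemma selected_sum:
  fixes f :: "nat \<Rightarrow> bit"
  assumes "\<alpha> \<in> carrier_vec m"
  shows "(\<Sum>j\<in>selected \<alpha>. f j) = (\<Sum>j = 0..<m. \<alpha> $ j * f j)"
proof -
  have "(\<Sum>j = 0..<m. \<alpha> $ j * f j) = (\<Sum>j = 0..<m. if \<alpha> $ j = 1 then f j else 0)"
    by (intro sum.cong) auto
  also have "\<dots> = (\<Sum>j | j \<in> {0..<m} \<and> \<alpha> $ j = 1. f j)"
    by (rule sum.inter_filter[symmetric]) simp
  finally show ?thesis using assms by (simp add: selected_def)
qed

lemma selected_subset: "\<alpha> \<in> carrier_vec m \<Longrightarrow> selected \<alpha> \<subseteq> {..<m}"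
  by (auto simp: selected_def)

lemma finite_selected [simp]: "finite (selected \<alpha>)"
  by (rule finite_subset[OF selected_subset[of _ "dim_vec \<alpha>"]]) auto

text \<open>The characteristic vector inverts \<open>selected\<close>, so every extraction rule
  comes from a binary selector.\<close>

lemma selected_indicator:
  assumes "S \<subseteq> {..<m}"
  shows "selected (vec m (\<lambda>j. of_bool (j \<in> S))) = S"
  using assms by (auto simp: selected_def)

text \<open>The product has as support the sum of the selected vectors, and coordinate by coordinate
  this sum is the transposed matrix applied to \<alpha>. It serves both the seam rows and the
  constraint rows.\<close>

lemma pauli_product_selected:
  assumes "set vs \<subseteq> carrier_vec n" and "\<alpha> \<in> carrier_vec (length vs)"
  shows "pauli_product P n (map ((!) vs) (sorted_list_of_set (selected \<alpha>))) =
    pauli_op P ((mat_of_rows n vs)\<^sup>T *\<^sub>v \<alpha>)"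
proof -
  let ?ws = "map ((!) vs) (sorted_list_of_set (selected \<alpha>))"
  have "\<And>j. j \<in> selected \<alpha> \<Longrightarrow> vs ! j \<in> set vs"
    using selected_subset[OF assms(2)] by auto
  then have ws: "set ?ws \<subseteq> carrier_vec n" using assms(1) by auto
  have "foldr (+) ?ws (0\<^sub>v n) = (mat_of_rows n vs)\<^sup>T *\<^sub>v \<alpha>"
  proof (rule eq_vecI)
    fix i assume "i < dim_vec ((mat_of_rows n vs)\<^sup>T *\<^sub>v \<alpha>)"
    then have i: "i < n" by simp
    have "foldr (+) ?ws (0\<^sub>v n) $ i = (\<Sum>j\<in>selected \<alpha>. vs ! j $ i)"
      using foldr_add_vec_index[OF ws i] by (simp add: sum_list_distinct_conv_sum_set o_def)
    also have "\<dots> = (\<Sum>j = 0..<length vs. \<alpha> $ j * vs ! j $ i)"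
      by (rule selected_sum[OF assms(2)])
    also have "\<dots> = (\<Sum>j = 0..<length vs. vs ! j $ i * \<alpha> $ j)"
      by (simp only: mult.commute)
    also have "\<dots> = ((mat_of_rows n vs)\<^sup>T *\<^sub>v \<alpha>) $ i"
      using i assms(2) by (simp add: scalar_prod_def mat_of_rows_index)
    finally show "foldr (+) ?ws (0\<^sub>v n) $ i = ((mat_of_rows n vs)\<^sup>T *\<^sub>v \<alpha>) $ i" .
  qed (use pauli_product_eq_pauli_op(2)[OF ws] in auto)
  with pauli_product_eq_pauli_op(1)[OF ws] show ?thesis by simp
qed

section \<open>Products of constraints fixed before the merge\<close>

text \<open>The list may repeat rows in any order. Each occurrence of row \<open>j\<close> adds the
  unit vector \<open>j\<close> to \<gamma>, so repetitions cancel modulo 2.\<close>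

lemma foldr_add_rows:
  fixes H :: "bit mat"
  assumes "H \<in> carrier_mat h n" and "set hs \<subseteq> set (rows H)"
  shows "\<exists>\<gamma> \<in> carrier_vec h. foldr (+) hs (0\<^sub>v n) = H\<^sup>T *\<^sub>v \<gamma>"
  using assms(2)
proof (induction hs)
  case Nil
  have "H\<^sup>T *\<^sub>v 0\<^sub>v h = 0\<^sub>v n" using assms(1) by (intro eq_vecI) auto
  then show ?case by (intro bexI[of _ "0\<^sub>v h"]) auto
next
  case (Cons v hs)
  then obtain \<gamma> where \<gamma>: "\<gamma> \<in> carrier_vec h" "foldr (+) hs (0\<^sub>v n) = H\<^sup>T *\<^sub>v \<gamma>" by auto
  from Cons.prems obtain j where j: "j < h" "v = row H j"
    using assms(1) by (auto simp: rows_def)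
  have "H\<^sup>T *\<^sub>v unit_vec h j = v"
    using assms(1) j by (intro eq_vecI) (auto simp: scalar_prod_right_unit)
  then have "foldr (+) (v # hs) (0\<^sub>v n) = H\<^sup>T *\<^sub>v (unit_vec h j + \<gamma>)"
    using assms(1) \<gamma> by (simp add: mult_add_distrib_mat_vec[where nr = n and nc = h])
  with \<gamma>(1) show ?case by (intro bexI[of _ "unit_vec h j + \<gamma>"]) auto
qed

text \<open>Turns the quantifier over lists of rows into one over coefficient vectors. Conversely,
  \<gamma> is realized by listing once each row that it selects.\<close>

lemma fixed_product_iff:
  assumes "H \<in> carrier_mat h n"
  shows "fixed_product P H A \<longleftrightarrow> (\<exists>\<gamma> \<in> carrier_vec h. A = pauli_op P (H\<^sup>T *\<^sub>v \<gamma>))"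
proof
  assume "fixed_product P H A"
  then obtain hs where hs: "set hs \<subseteq> set (rows H)" "A = pauli_product P n hs"
    using assms by (auto simp: fixed_product_def)
  moreover have "set hs \<subseteq> carrier_vec n"
    using hs(1) assms rows_carrier[of H] by auto
  ultimately show "\<exists>\<gamma> \<in> carrier_vec h. A = pauli_op P (H\<^sup>T *\<^sub>v \<gamma>)"
    using foldr_add_rows[OF assms hs(1)] pauli_product_eq_pauli_op(1) by metis
next
  assume "\<exists>\<gamma> \<in> carrier_vec h. A = pauli_op P (H\<^sup>T *\<^sub>v \<gamma>)"
  then obtain \<gamma> where \<gamma>: "\<gamma> \<in> carrier_vec h" "A = pauli_op P (H\<^sup>T *\<^sub>v \<gamma>)" by auto
  let ?hs = "map ((!) (rows H)) (sorted_list_of_set (selected \<gamma>))"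
  have "pauli_product P n ?hs = pauli_op P ((mat_of_rows n (rows H))\<^sup>T *\<^sub>v \<gamma>)"
    using assms \<gamma>(1) rows_carrier[of H] by (intro pauli_product_selected) auto
  also have "mat_of_rows n (rows H) = H" using assms by auto
  finally have "A = pauli_product P n ?hs" using \<gamma>(2) by simp
  moreover have "set ?hs \<subseteq> set (rows H)"
    using selected_subset[OF \<gamma>(1)] assms by (auto intro!: nth_mem)
  ultimately show "fixed_product P H A"
    using assms unfolding fixed_product_def by (intro exI[of _ ?hs]) auto
qed

section \<open>The extraction criterion as a linear equation\<close>

lemma mat_of_row_mult:
  fixes A :: "'a :: comm_semiring_0 mat"
  assumes "A \<in> carrier_mat m n" and "v \<in> carrier_vec m"
  shows "mat_of_row v * A = mat_of_row (A\<^sup>T *\<^sub>v v)"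
proof (rule eq_matI)
  fix i j assume "i < dim_row (mat_of_row (A\<^sup>T *\<^sub>v v))" "j < dim_col (mat_of_row (A\<^sup>T *\<^sub>v v))"
  then show "(mat_of_row v * A) $$ (i, j) = mat_of_row (A\<^sup>T *\<^sub>v v) $$ (i, j)"
    using assms by (auto simp: comm_scalar_prod[of v m])
qed (use assms in auto)

lemma mat_of_row_eq_iff: "mat_of_row u = mat_of_row v \<longleftrightarrow> u = v"
  by (metis row_mat_of_row)

lemma mat_of_row_add:
  assumes "u \<in> carrier_vec n" and "v \<in> carrier_vec n"
  shows "mat_of_row u + mat_of_row v = mat_of_row (u + v)"
  using assms by (intro eq_matI) auto

text \<open>In characteristic 2 the constraint term moves across the equation without changing sign.
  The right-hand form mirrors the shape \<open>pauli_op P l * D\<close> in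
  \<open>extracts\<close>.\<close>

lemma row_combination_eq_iff:
  fixes E H :: "bit mat"
  assumes "E \<in> carrier_mat m n" "H \<in> carrier_mat h n" "l \<in> carrier_vec n"
    and "\<alpha> \<in> carrier_vec m" "\<gamma> \<in> carrier_vec h"
  shows "mat_of_row \<alpha> * E + mat_of_row \<gamma> * H = mat_of_row l \<longleftrightarrow>
    E\<^sup>T *\<^sub>v \<alpha> = l + H\<^sup>T *\<^sub>v \<gamma>"
proof -
  let ?u = "E\<^sup>T *\<^sub>v \<alpha>" and ?w = "H\<^sup>T *\<^sub>v \<gamma>"
  have uw: "?u \<in> carrier_vec n" "?w \<in> carrier_vec n" using assms by auto
  have "mat_of_row \<alpha> * E + mat_of_row \<gamma> * H = mat_of_row l \<longleftrightarrow> ?u + ?w = l"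
    using assms uw by (simp add: mat_of_row_mult mat_of_row_add[where n = n] mat_of_row_eq_iff)
  also have "\<dots> \<longleftrightarrow> ?u = l + ?w"
  proof
    assume "?u + ?w = l"
    then have "l + ?w = ?u + (?w + ?w)" using uw by (auto simp: assoc_add_vec[OF uw uw(2)])
    then show "?u = l + ?w" using uw by (simp add: bit_vec_add_self[OF uw(2)])
  next
    assume "?u = l + ?w"
    then have "?u + ?w = l + (?w + ?w)" using assms(3) uw(2) by (simp add: assoc_add_vec[OF _ uw(2) uw(2)])
    then show "?u + ?w = l" using assms(3) by (simp add: bit_vec_add_self[OF uw(2)])
  qed
  finally show ?thesis .
qed

text \<open>Each operator in \<open>extracts\<close> is some P(v): the seam product by selection of
  rows, the correction \<open>D\<close> by \<open>fixed_product_iff\<close>. Injectivity then strips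
  off the operators and leaves an equation of supports.\<close>

lemma extracts_selected_iff:
  assumes "\<And>r. r \<in> set M \<Longrightarrow> seam_support r \<in> carrier_vec n"
    and "H \<in> carrier_mat h n" "l \<in> carrier_vec n" "\<alpha> \<in> carrier_vec (length M)"
  shows "extracts P n M H l (selected \<alpha>) \<longleftrightarrow>
    (\<exists>\<gamma> \<in> carrier_vec h.
       mat_of_row \<alpha> * effective_row_matrix n M + mat_of_row \<gamma> * H = mat_of_row l)"
proof -
  let ?E = "effective_row_matrix n M" and ?vs = "map seam_support M"
  have E: "?E \<in> carrier_mat (length M) n" by (auto simp: effective_row_matrix_def)
  have sel: "selected \<alpha> \<subseteq> {..<length M}" by (rule selected_subset[OF assms(4)])
  have "seam_product P n M (selected \<alpha>) =
      pauli_product P n (map ((!) ?vs) (sorted_list_of_set (selected \<alpha>)))"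
    unfolding seam_product_def using sel
    by (intro arg_cong[where f = "pauli_product P n"] map_cong refl) (auto simp: subset_iff)
  also have "\<dots> = pauli_op P (?E\<^sup>T *\<^sub>v \<alpha>)"
    unfolding effective_row_matrix_def using assms by (intro pauli_product_selected) auto
  finally have "extracts P n M H l (selected \<alpha>) \<longleftrightarrow>
      (\<exists>\<gamma> \<in> carrier_vec h. pauli_op P (?E\<^sup>T *\<^sub>v \<alpha>) = pauli_op P l * pauli_op P (H\<^sup>T *\<^sub>v \<gamma>))"
    using sel unfolding extracts_def fixed_product_iff[OF assms(2)] by auto
  also have "\<dots> \<longleftrightarrow> (\<exists>\<gamma> \<in> carrier_vec h. ?E\<^sup>T *\<^sub>v \<alpha> = l + H\<^sup>T *\<^sub>v \<gamma>)"
  proof (rule bex_cong[OF refl])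
    fix \<gamma> :: "bit vec" assume "\<gamma> \<in> carrier_vec h"
    then have carr: "H\<^sup>T *\<^sub>v \<gamma> \<in> carrier_vec n" "?E\<^sup>T *\<^sub>v \<alpha> \<in> carrier_vec n"
      using assms E by auto
    show "pauli_op P (?E\<^sup>T *\<^sub>v \<alpha>) = pauli_op P l * pauli_op P (H\<^sup>T *\<^sub>v \<gamma>) \<longleftrightarrow>
        ?E\<^sup>T *\<^sub>v \<alpha> = l + H\<^sup>T *\<^sub>v \<gamma>"
      \<comment> \<open>The homomorphism rule merges the right-hand product into a single operator,
        so that injectivity applies.\<close>
      using pauli_op_inj[of "?E\<^sup>T *\<^sub>v \<alpha>" n "l + H\<^sup>T *\<^sub>v \<gamma>" P] carr assms(3)
      by (auto simp: pauli_op_add[where n = n])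
  qed
  also have "\<dots> \<longleftrightarrow> (\<exists>\<gamma> \<in> carrier_vec h.
      mat_of_row \<alpha> * ?E + mat_of_row \<gamma> * H = mat_of_row l)"
    using row_combination_eq_iff[OF E assms(2-4)] by auto
  finally show ?thesis .
qed

section \<open>Outcome parities and signs\<close>

text \<open>The inferred outcomes form the vector obtained by applying the inference matrix to
  \<open>s\<close>. Pairing it with \<alpha> and moving the matrix to the other side by
  transposition gives the raw selector.\<close>

lemma extracted_parity_selected:
  assumes "\<And>r. r \<in> set M \<Longrightarrow> seam_selector r \<in> carrier_vec N"
    and "\<alpha> \<in> carrier_vec (length M)" and "s \<in> carrier_vec N"
  shows "extracted_parity M (selected \<alpha>) s = ((inference_matrix N M)\<^sup>T *\<^sub>v \<alpha>) \<bullet> s"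
proof -
  let ?O = "inference_matrix N M"
  have O: "?O \<in> carrier_mat (length M) N" by (auto simp: inference_matrix_def)
  have "extracted_parity M (selected \<alpha>) s = (\<Sum>j = 0..<length M. \<alpha> $ j * (seam_selector (M ! j) \<bullet> s))"
    unfolding extracted_parity_def inferred_outcome_def by (rule selected_sum[OF assms(2)])
  also have "\<dots> = \<alpha> \<bullet> (?O *\<^sub>v s)"
    using assms(1) by (auto simp: scalar_prod_def[of \<alpha>] inference_matrix_def mat_of_rows_row intro!: sum.cong)
  also have "\<dots> = (?O\<^sup>T *\<^sub>v \<alpha>) \<bullet> s"
    using transpose_vec_mult_scalar[OF O assms(3,2)] by simp
  finally show ?thesis .
qed

lemma outcome_sign_add: "outcome_sign (a + b) = outcome_sign a * outcome_sign b"
  by (cases a; cases b) (auto simp: outcome_sign_def)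

text \<open>The map from b to (-1)^b turns XOR into multiplication. For infinite \<open>S\<close>
  both sides are 1, by the default values of sum and product.\<close>

lemma recorded_sign_eq: "recorded_sign M S s = outcome_sign (extracted_parity M S s)"
  unfolding recorded_sign_def extracted_parity_def
  by (induction S rule: infinite_finite_induct) (auto simp: outcome_sign_add, auto simp: outcome_sign_def)

section \<open>The criterion and the induced raw-outcome selector\<close>

theorem theorem1:
  fixes P :: pauli_type
    and n N m h :: nat
    and env :: "('src, 'ori) merge_env"
    and M :: "('src, 'ori) seam_row list"
    and E Otilde Hsep Hsep_opp :: "bit mat"
    and QA QB :: "nat set"
    and lA lB l :: "bit vec"
  assumes "admissible_seam_set env P n N M" and "length M = m"
    and "E = effective_row_matrix n M" and "Otilde = inference_matrix N M"
    and "separated_code P n Hsep Hsep_opp" and "Hsep \<in> carrier_mat h n"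
    and "joint_logical_representative P n Hsep Hsep_opp QA QB lA lB l"
  shows "(can_extract P n M Hsep l \<longleftrightarrow>
      (\<exists>\<alpha> \<in> carrier_vec m. \<exists>\<gamma> \<in> carrier_vec h.
         mat_of_row \<alpha> * E + mat_of_row \<gamma> * Hsep = mat_of_row l)) \<and>
    (\<forall>\<alpha> \<in> carrier_vec m. \<forall>\<gamma> \<in> carrier_vec h.
      mat_of_row \<alpha> * E + mat_of_row \<gamma> * Hsep = mat_of_row l \<longrightarrow>
        extracts P n M Hsep l (selected \<alpha>) \<and>
        (\<exists>\<beta> \<in> carrier_vec N. \<beta> = Otilde\<^sup>T *\<^sub>v \<alpha> \<and>
          (\<forall>s \<in> carrier_vec N.
             extracted_parity M (selected \<alpha>) s = \<beta> \<bullet> s \<and>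
             recorded_sign M (selected \<alpha>) s = outcome_sign (\<beta> \<bullet> s) \<and>
             (\<forall>outcome. (s, outcome) \<in> env_runs env \<longrightarrow>
                (\<Sum>j\<in>selected \<alpha>. outcome (seam_support (M ! j)) (seam_metadata (M ! j)))
                  = \<beta> \<bullet> s))))"
proof -
  have adm: "admissible_row env P n N r" if "r \<in> set M" for r
    using assms(1) that by (simp add: admissible_seam_set_def)
  have support: "seam_support r \<in> carrier_vec n" and selector: "seam_selector r \<in> carrier_vec N"
    if "r \<in> set M" for r
    using adm[OF that] by (auto simp: admissible_row_def)
  have l: "l \<in> carrier_vec n"
    using assms(7) by (simp add: joint_logical_representative_def)
  \<comment> \<open>The equivalence is kept for each single \<alpha>: quantified over \<alpha> it
    gives the criterion, and for a given solution it shows that this very selection extracts the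
    parity.\<close>
  have extracts_iff: "extracts P n M Hsep l (selected \<alpha>) \<longleftrightarrow>
      (\<exists>\<gamma> \<in> carrier_vec h. mat_of_row \<alpha> * E + mat_of_row \<gamma> * Hsep = mat_of_row l)"
    if "\<alpha> \<in> carrier_vec m" for \<alpha>
    using extracts_selected_iff[OF support assms(6) l, of M \<alpha> P] that assms(2,3) by simp
  have "can_extract P n M Hsep l \<longleftrightarrow> (\<exists>\<alpha> \<in> carrier_vec m. extracts P n M Hsep l (selected \<alpha>))"
  proof
    assume "can_extract P n M Hsep l"
    then obtain S where S: "extracts P n M Hsep l S" by (auto simp: can_extract_def)
    then have "selected (vec m (\<lambda>j. of_bool (j \<in> S))) = S"
      using assms(2) by (intro selected_indicator) (auto simp: extracts_def)
    with S show "\<exists>\<alpha> \<in> carrier_vec m. extracts P n M Hsep l (selected \<alpha>)"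
      by (intro bexI[of _ "vec m (\<lambda>j. of_bool (j \<in> S))"]) auto
  qed (auto simp: can_extract_def)
  then have iff: "can_extract P n M Hsep l \<longleftrightarrow>
      (\<exists>\<alpha> \<in> carrier_vec m. \<exists>\<gamma> \<in> carrier_vec h.
         mat_of_row \<alpha> * E + mat_of_row \<gamma> * Hsep = mat_of_row l)"
    using extracts_iff by auto
  have parity: "extracted_parity M (selected \<alpha>) s = (Otilde\<^sup>T *\<^sub>v \<alpha>) \<bullet> s"
    if "\<alpha> \<in> carrier_vec m" "s \<in> carrier_vec N" for \<alpha> s
    using extracted_parity_selected[OF selector, of M \<alpha> s] that assms(2,4) by simp
  \<comment> \<open>Admissibility ties the outcome of each seam operator in a run to its selector
    applied to the raw record, so the XOR of these outcomes agrees with the inferred parity term by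
    term.\<close>
  have outcomes: "(\<Sum>j\<in>selected \<alpha>. outcome (seam_support (M ! j)) (seam_metadata (M ! j)))
      = extracted_parity M (selected \<alpha>) s"
    if "\<alpha> \<in> carrier_vec m" "s \<in> carrier_vec N" "(s, outcome) \<in> env_runs env" for \<alpha> s outcome
    unfolding extracted_parity_def inferred_outcome_def
  proof (rule sum.cong[OF refl])
    fix j assume "j \<in> selected \<alpha>"
    then have "M ! j \<in> set M" using selected_subset[OF that(1)] assms(2) by auto
    then have "\<forall>(s, outcome) \<in> env_runs env. s \<in> carrier_vec N \<longrightarrow>
        outcome (seam_support (M ! j)) (seam_metadata (M ! j)) = seam_selector (M ! j) \<bullet> s"
      using adm unfolding admissible_row_def by blast
    with that(2,3) show "outcome (seam_support (M ! j)) (seam_metadata (M ! j)) = seam_selector (M ! j) \<bullet> s"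
      by auto
  qed
  have "Otilde\<^sup>T *\<^sub>v \<alpha> \<in> carrier_vec N" for \<alpha>
    unfolding assms(4) inference_matrix_def by (intro carrier_vecI) simp
  with parity outcomes have raw_selector:
    "\<exists>\<beta> \<in> carrier_vec N. \<beta> = Otilde\<^sup>T *\<^sub>v \<alpha> \<and>
       (\<forall>s \<in> carrier_vec N.
          extracted_parity M (selected \<alpha>) s = \<beta> \<bullet> s \<and>
          recorded_sign M (selected \<alpha>) s = outcome_sign (\<beta> \<bullet> s) \<and>
          (\<forall>outcome. (s, outcome) \<in> env_runs env \<longrightarrow>
             (\<Sum>j\<in>selected \<alpha>. outcome (seam_support (M ! j)) (seam_metadata (M ! j)))
               = \<beta> \<bullet> s))"
    if "\<alpha> \<in> carrier_vec m" for \<alpha>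
    using that by (simp add: recorded_sign_eq)
  show ?thesis
    using iff extracts_iff raw_selector by blast
qed

end
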